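(* Let $n>0$ be an integer, $q\in k$ an invertible scalar, and $E$ a $k$-vector space with basis $(a_i)_{0\le i\le n-1}\cup(x_i)_{0\le i\le n-1}$. Define linear maps $\delta,\hat\delta:E\to E^{\otimes2}$ by, for all $0\le i\le n-1$ (sums over integers $j,k\ge0$ with $j+k=i$), $$\delta(a_i)=\sum_{j+k=i}a_j\otimes a_k,\qquad\delta(x_i)=\sum_{j+k=i}a_j\otimes x_k,\qquad\hat\delta(a_i)=0,\qquad\hat\delta(x_i)=\sum_{j+k=i}q^k\,x_j\otimes a_k .$$ Then $(E,\delta,\hat\delta)$ is a dendriform coalgebra.
   Context: $k$ is $\mathbb{R}$ or $\mathbb{C}$. Dendriform coalgebra $(Z,\delta,\hat\delta)$: a vector space with linear maps $\delta,\hat\delta:Z\to Z^{\otimes2}$ such that 1. $(id\otimes(\delta+\hat\delta))\hat\delta=(\hat\delta\otimes id)\hat\delta$; 2. $(id\otimes\hat\delta)\delta=(\delta\otimes id)\hat\delta$; 3. $((\hat\delta+\delta)\otimes id)\delta=(id\otimes\delta)\delta$. *)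

theory Defs
  imports Complex_Main "HOL-Library.Function_Algebras"
begin

text \<open>Every vector space over \<open>'k\<close> is a type with a scalar multiplication
  \<open>scale\<close> satisfying the locale \<^locale>\<open>vector_space\<close>.\<close>

definition real_or_complex :: "'k::field itself \<Rightarrow> bool" where
  "real_or_complex _ \<longleftrightarrow>
     (\<exists>f :: 'k \<Rightarrow> real. bij f \<and> f 1 = 1 \<and>
        (\<forall>x y. f (x + y) = f x + f y) \<and> (\<forall>x y. f (x * y) = f x * f y)) \<or>
     (\<exists>f :: 'k \<Rightarrow> complex. bij f \<and> f 1 = 1 \<and>
        (\<forall>x y. f (x + y) = f x + f y) \<and> (\<forall>x y. f (x * y) = f x * f y))"

section \<open>Tensor powers\<close>

text \<open>
  A quotient of a free vector space cannot be made into a type, since it would depend on the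
  scalar multiplication. We therefore use the concrete model of \<open>V \<otimes> V\<close> as the space of
  functionals on bilinear forms spanned by the evaluations \<open>u \<otimes> v = (B \<mapsto> B u v)\<close>, and the
  analogous model of \<open>V \<otimes> V \<otimes> V\<close>. For vector spaces of any dimension this is a tensor product:
  see the universal properties \<open>tensor2_universal\<close> and \<open>tensor3_universal\<close> below.
  Functionals are set to 0 on arguments that are not bilinear (trilinear) forms.
\<close>

definition bilinear_form :: "('k::field \<Rightarrow> 'v::ab_group_add \<Rightarrow> 'v) \<Rightarrow> ('v \<Rightarrow> 'v \<Rightarrow> 'k) \<Rightarrow> bool" where
  "bilinear_form scale B \<longleftrightarrow>
     (\<forall>u. Vector_Spaces.linear scale (*) (\<lambda>v. B u v)) \<and>
     (\<forall>v. Vector_Spaces.linear scale (*) (\<lambda>u. B u v))"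

definition trilinear_form ::
    "('k::field \<Rightarrow> 'v::ab_group_add \<Rightarrow> 'v) \<Rightarrow> ('v \<Rightarrow> 'v \<Rightarrow> 'v \<Rightarrow> 'k) \<Rightarrow> bool" where
  "trilinear_form scale B \<longleftrightarrow>
     (\<forall>u v. Vector_Spaces.linear scale (*) (\<lambda>w. B u v w)) \<and>
     (\<forall>u w. Vector_Spaces.linear scale (*) (\<lambda>v. B u v w)) \<and>
     (\<forall>v w. Vector_Spaces.linear scale (*) (\<lambda>u. B u v w))"

type_synonym ('v, 'k) tensor2 = "('v \<Rightarrow> 'v \<Rightarrow> 'k) \<Rightarrow> 'k"
type_synonym ('v, 'k) tensor3 = "('v \<Rightarrow> 'v \<Rightarrow> 'v \<Rightarrow> 'k) \<Rightarrow> 'k"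

definition fun_scale :: "'k::field \<Rightarrow> ('b \<Rightarrow> 'k) \<Rightarrow> ('b \<Rightarrow> 'k)" where
  "fun_scale c t = (\<lambda>B. c * t B)"

definition tprod2 ::
    "('k::field \<Rightarrow> 'v::ab_group_add \<Rightarrow> 'v) \<Rightarrow> 'v \<Rightarrow> 'v \<Rightarrow> ('v, 'k) tensor2" where
  "tprod2 scale u v = (\<lambda>B. if bilinear_form scale B then B u v else 0)"

definition tprod3 ::
    "('k::field \<Rightarrow> 'v::ab_group_add \<Rightarrow> 'v) \<Rightarrow> 'v \<Rightarrow> 'v \<Rightarrow> 'v \<Rightarrow> ('v, 'k) tensor3" where
  "tprod3 scale u v w = (\<lambda>B. if trilinear_form scale B then B u v w else 0)"

definition tensor2_space ::
    "('k::field \<Rightarrow> 'v::ab_group_add \<Rightarrow> 'v) \<Rightarrow> ('v, 'k) tensor2 set" where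
  "tensor2_space scale = module.span fun_scale {tprod2 scale u v | u v. True}"

definition tensor3_space ::
    "('k::field \<Rightarrow> 'v::ab_group_add \<Rightarrow> 'v) \<Rightarrow> ('v, 'k) tensor3 set" where
  "tensor3_space scale = module.span fun_scale {tprod3 scale u v w | u v w. True}"

definition linear_to_tensor2 ::
    "('k::field \<Rightarrow> 'v::ab_group_add \<Rightarrow> 'v) \<Rightarrow> ('v \<Rightarrow> ('v, 'k) tensor2) \<Rightarrow> bool" where
  "linear_to_tensor2 scale f \<longleftrightarrow>
     Vector_Spaces.linear scale fun_scale f \<and> range f \<subseteq> tensor2_space scale"

text \<open>
  The maps \<open>id \<otimes> f\<close> and \<open>f \<otimes> id\<close> from \<open>V \<otimes> V\<close> to \<open>V \<otimes> V \<otimes> V\<close> for a linear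
  \<open>f : V \<rightarrow> V \<otimes> V\<close>. Evaluating \<open>v \<otimes> f w\<close> at a trilinear form \<open>B\<close> amounts to
  evaluating \<open>f w\<close> at the bilinear form \<open>B v\<close>, whence the formula; the lemmas
  \<open>id_tensor_tprod2\<close> and \<open>tensor_id_tprod2\<close> give the values on \<open>v \<otimes> w\<close>.
\<close>

definition id_tensor ::
    "('k::field \<Rightarrow> 'v::ab_group_add \<Rightarrow> 'v) \<Rightarrow> ('v \<Rightarrow> ('v, 'k) tensor2)
      \<Rightarrow> ('v, 'k) tensor2 \<Rightarrow> ('v, 'k) tensor3" where
  "id_tensor scale f t =
     (\<lambda>B. if trilinear_form scale B then t (\<lambda>v w. f w (\<lambda>x y. B v x y)) else 0)"

definition tensor_id ::
    "('k::field \<Rightarrow> 'v::ab_group_add \<Rightarrow> 'v) \<Rightarrow> ('v \<Rightarrow> ('v, 'k) tensor2)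
      \<Rightarrow> ('v, 'k) tensor2 \<Rightarrow> ('v, 'k) tensor3" where
  "tensor_id scale f t =
     (\<lambda>B. if trilinear_form scale B then t (\<lambda>v w. f v (\<lambda>x y. B x y w)) else 0)"

section \<open>Dendriform coalgebras\<close>

locale dendriform_coalgebra = vector_space scale
  for scale :: "'k::field \<Rightarrow> 'v::ab_group_add \<Rightarrow> 'v" +
  fixes \<delta> \<delta>h :: "'v \<Rightarrow> ('v, 'k) tensor2"
  assumes linear_\<delta>: "linear_to_tensor2 scale \<delta>"
    and linear_\<delta>h: "linear_to_tensor2 scale \<delta>h"
    and coassoc1: "id_tensor scale (\<delta> + \<delta>h) \<circ> \<delta>h = tensor_id scale \<delta>h \<circ> \<delta>h"
    and coassoc2: "id_tensor scale \<delta>h \<circ> \<delta> = tensor_id scale \<delta> \<circ> \<delta>h"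
    and coassoc3: "tensor_id scale (\<delta>h + \<delta>) \<circ> \<delta> = id_tensor scale \<delta> \<circ> \<delta>"

section \<open>Adequacy of the tensor model\<close>

lemma vector_space_fun_scale: "vector_space fun_scale"
  by unfold_locales (auto simp: fun_scale_def fun_eq_iff algebra_simps)

lemma vector_space_field: "vector_space ((*) :: 'k::field \<Rightarrow> 'k \<Rightarrow> 'k)"
  by unfold_locales (auto simp: algebra_simps)

lemma linear_eval: "Vector_Spaces.linear fun_scale (*) (\<lambda>t. t B)"
  by (auto simp: Vector_Spaces.linear_iff vector_space_fun_scale vector_space_field fun_scale_def)

lemma separating_functional:
  assumes "vector_space s" and "y \<noteq> 0"
  obtains \<phi> where "Vector_Spaces.linear s (*) \<phi>" and "\<phi> y = 1"
proof -
  interpret p: vector_space_pair s "(*)"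
    using assms vector_space_field by (simp add: vector_space_pair_def)
  have "\<not> p.vs1.dependent {y}"
    using assms(2) by (simp add: p.vs1.dependent_single)
  from p.linear_independent_extend[OF this, of "\<lambda>_. 1"] that show thesis by auto
qed

lemma evaluations_universal:
  fixes ev :: "'i \<Rightarrow> 'b \<Rightarrow> 'k::field" and s' :: "'k \<Rightarrow> 'u::ab_group_add \<Rightarrow> 'u"
  assumes "vector_space s'"
    and "\<And>\<phi>. Vector_Spaces.linear s' (*) \<phi> \<Longrightarrow> \<exists>\<beta>. \<forall>i. ev i \<beta> = \<phi> (g i)"
  obtains h where "Vector_Spaces.linear fun_scale s' h" and "\<And>i. h (ev i) = g i"
proof -
  interpret p: vector_space_pair "fun_scale :: 'k \<Rightarrow> ('b \<Rightarrow> 'k) \<Rightarrow> _" s'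
    using assms vector_space_fun_scale by (simp add: vector_space_pair_def)
  interpret p': vector_space_pair "fun_scale :: 'k \<Rightarrow> ('b \<Rightarrow> 'k) \<Rightarrow> _" "(*) :: 'k \<Rightarrow> 'k \<Rightarrow> 'k"
    using vector_space_field vector_space_fun_scale by (simp add: vector_space_pair_def)
  obtain C where C: "C \<subseteq> range ev" "p.vs1.independent C" "range ev \<subseteq> p.vs1.span C"
    using p.vs1.maximal_independent_subset[of "range ev"] by blast
  obtain h where h: "Vector_Spaces.linear fun_scale s' h" "\<forall>b\<in>C. h b = g (inv ev b)"
    using p.linear_independent_extend[OF C(2), of "\<lambda>b. g (inv ev b)"] by blast
  have "h (ev i) = g i" for i
  proof (rule ccontr)
    assume "h (ev i) \<noteq> g i"
    then obtain \<phi> where \<phi>: "Vector_Spaces.linear s' (*) \<phi>" "\<phi> (h (ev i) - g i) = 1"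
      using separating_functional[OF assms(1), of "h (ev i) - g i"] by auto
    obtain \<beta> where \<beta>: "\<forall>i. ev i \<beta> = \<phi> (g i)" using assms(2)[OF \<phi>(1)] by blast
    have lin: "Vector_Spaces.linear fun_scale (*) (\<lambda>t. \<phi> (h t))"
      using Vector_Spaces.linear_compose[OF h(1) \<phi>(1)] by (simp add: o_def)
    have "\<phi> (h (ev i)) = ev i \<beta>"
    proof (rule p'.linear_eq_on[OF lin linear_eval[of \<beta>]])
      show "ev i \<in> p.vs1.span C" using C(3) by blast
      show "\<phi> (h b) = b \<beta>" if "b \<in> C" for b
      proof -
        have "ev (inv ev b) = b" using that C(1) by (auto intro: f_inv_into_f)
        moreover have "\<phi> (h b) = ev (inv ev b) \<beta>" using h(2) that \<beta> by simp
        ultimately show ?thesis by simp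
      qed
    qed
    then have "\<phi> (h (ev i) - g i) = 0"
      using \<beta> \<phi>(1) by (simp add: module_hom.diff[OF \<phi>(1)[unfolded linear_iff_module_hom]])
    then show False using \<phi>(2) by simp
  qed
  then show thesis using h(1) that by blast
qed

lemma bilinear_form_tprod2:
  assumes "vector_space scale"
  shows "Vector_Spaces.linear scale fun_scale (\<lambda>v. tprod2 scale u v)"
    and "Vector_Spaces.linear scale fun_scale (\<lambda>u. tprod2 scale u v)"
  using assms vector_space_fun_scale
  by (auto simp: Vector_Spaces.linear_iff tprod2_def fun_scale_def bilinear_form_def fun_eq_iff)

lemma trilinear_form_tprod3:
  assumes "vector_space scale"
  shows "Vector_Spaces.linear scale fun_scale (\<lambda>w. tprod3 scale u v w)"
    and "Vector_Spaces.linear scale fun_scale (\<lambda>v. tprod3 scale u v w)"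
    and "Vector_Spaces.linear scale fun_scale (\<lambda>u. tprod3 scale u v w)"
  using assms vector_space_fun_scale
  by (auto simp: Vector_Spaces.linear_iff tprod3_def fun_scale_def trilinear_form_def fun_eq_iff)

text \<open>The factorization \<open>h\<close> is defined on all functionals; it is unique on the tensor power.\<close>

theorem tensor2_universal:
  fixes s' :: "'k::field \<Rightarrow> 'u::ab_group_add \<Rightarrow> 'u"
  assumes "vector_space s'"
    and g: "\<And>u. Vector_Spaces.linear scale s' (\<lambda>v. g u v)"
      "\<And>v. Vector_Spaces.linear scale s' (\<lambda>u. g u v)"
  obtains h where "Vector_Spaces.linear fun_scale s' h"
    and "\<And>u v. h (tprod2 scale u v) = g u v"
    and "\<And>h' t. \<lbrakk>Vector_Spaces.linear fun_scale s' h'; \<And>u v. h' (tprod2 scale u v) = g u v;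
           t \<in> tensor2_space scale\<rbrakk> \<Longrightarrow> h' t = h t"
proof -
  have "\<exists>\<beta>. \<forall>i. tprod2 scale (fst i) (snd i) \<beta> = \<phi> (g (fst i) (snd i))"
    if "Vector_Spaces.linear s' (*) \<phi>" for \<phi>
  proof (intro exI[of _ "\<lambda>u v. \<phi> (g u v)"])
    have "bilinear_form scale (\<lambda>u v. \<phi> (g u v))"
      using Vector_Spaces.linear_compose[OF g(1) that] Vector_Spaces.linear_compose[OF g(2) that]
      by (simp add: bilinear_form_def o_def)
    then show "\<forall>i. tprod2 scale (fst i) (snd i) (\<lambda>u v. \<phi> (g u v)) = \<phi> (g (fst i) (snd i))"
      by (simp add: tprod2_def)
  qed
  from evaluations_universal[OF assms(1), of "\<lambda>i. tprod2 scale (fst i) (snd i)" "\<lambda>i. g (fst i) (snd i)", OF this]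
  obtain h where h: "Vector_Spaces.linear fun_scale s' h"
    "\<And>i. h (tprod2 scale (fst i) (snd i)) = g (fst i) (snd i)" by blast
  interpret p: vector_space_pair "fun_scale :: 'k \<Rightarrow> _ \<Rightarrow> ('a, 'k) tensor2" s'
    using assms vector_space_fun_scale by (simp add: vector_space_pair_def)
  have hh: "h (tprod2 scale u v) = g u v" for u v using h(2)[of "(u, v)"] by simp
  show thesis
  proof (rule that[OF h(1) hh])
    show "h' t = h t" if "Vector_Spaces.linear fun_scale s' h'"
      "\<And>u v. h' (tprod2 scale u v) = g u v" "t \<in> tensor2_space scale" for h' t
      by (rule p.linear_eq_on[OF that(1) h(1) that(3)[unfolded tensor2_space_def]])
        (use that(2) hh in auto)
  qed
qed

theorem tensor3_universal:
  fixes s' :: "'k::field \<Rightarrow> 'u::ab_group_add \<Rightarrow> 'u"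
  assumes "vector_space s'"
    and g: "\<And>u v. Vector_Spaces.linear scale s' (\<lambda>w. g u v w)"
      "\<And>u w. Vector_Spaces.linear scale s' (\<lambda>v. g u v w)"
      "\<And>v w. Vector_Spaces.linear scale s' (\<lambda>u. g u v w)"
  obtains h where "Vector_Spaces.linear fun_scale s' h"
    and "\<And>u v w. h (tprod3 scale u v w) = g u v w"
    and "\<And>h' t. \<lbrakk>Vector_Spaces.linear fun_scale s' h'; \<And>u v w. h' (tprod3 scale u v w) = g u v w;
           t \<in> tensor3_space scale\<rbrakk> \<Longrightarrow> h' t = h t"
proof -
  have "\<exists>\<beta>. \<forall>i. tprod3 scale (fst i) (fst (snd i)) (snd (snd i)) \<beta>
      = \<phi> (g (fst i) (fst (snd i)) (snd (snd i)))"
    if "Vector_Spaces.linear s' (*) \<phi>" for \<phi>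
  proof (intro exI[of _ "\<lambda>u v w. \<phi> (g u v w)"])
    have "trilinear_form scale (\<lambda>u v w. \<phi> (g u v w))"
      using Vector_Spaces.linear_compose[OF g(1) that] Vector_Spaces.linear_compose[OF g(2) that]
        Vector_Spaces.linear_compose[OF g(3) that]
      by (simp add: trilinear_form_def o_def)
    then show "\<forall>i. tprod3 scale (fst i) (fst (snd i)) (snd (snd i)) (\<lambda>u v w. \<phi> (g u v w))
        = \<phi> (g (fst i) (fst (snd i)) (snd (snd i)))"
      by (simp add: tprod3_def)
  qed
  from evaluations_universal[OF assms(1),
      of "\<lambda>i. tprod3 scale (fst i) (fst (snd i)) (snd (snd i))"
        "\<lambda>i. g (fst i) (fst (snd i)) (snd (snd i))", OF this]
  obtain h where h: "Vector_Spaces.linear fun_scale s' h"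
    "\<And>i. h (tprod3 scale (fst i) (fst (snd i)) (snd (snd i)))
       = g (fst i) (fst (snd i)) (snd (snd i))" by blast
  interpret p: vector_space_pair "fun_scale :: 'k \<Rightarrow> _ \<Rightarrow> ('a, 'k) tensor3" s'
    using assms vector_space_fun_scale by (simp add: vector_space_pair_def)
  have hh: "h (tprod3 scale u v w) = g u v w" for u v w using h(2)[of "(u, v, w)"] by simp
  show thesis
  proof (rule that[OF h(1) hh])
    show "h' t = h t" if "Vector_Spaces.linear fun_scale s' h'"
      "\<And>u v w. h' (tprod3 scale u v w) = g u v w" "t \<in> tensor3_space scale" for h' t
      by (rule p.linear_eq_on[OF that(1) h(1) that(3)[unfolded tensor3_space_def]])
        (use that(2) hh in auto)
  qed
qed

lemma linear_id_tensor: "Vector_Spaces.linear fun_scale fun_scale (id_tensor scale f)"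
  by (auto simp: Vector_Spaces.linear_iff vector_space_fun_scale id_tensor_def fun_scale_def
      fun_eq_iff)

lemma linear_tensor_id: "Vector_Spaces.linear fun_scale fun_scale (tensor_id scale f)"
  by (auto simp: Vector_Spaces.linear_iff vector_space_fun_scale tensor_id_def fun_scale_def
      fun_eq_iff)

lemma tensor2_space_linear:
  assumes "vector_space scale" and "t \<in> tensor2_space scale"
    and "\<And>v. bilinear_form scale (\<lambda>x y. B v x y)"
    and "\<And>x y. Vector_Spaces.linear scale (*) (\<lambda>v. B v x y)"
  shows "Vector_Spaces.linear scale (*) (\<lambda>v. t (B v))"
proof -
  interpret v: vector_space fun_scale by (rule vector_space_fun_scale)
  show ?thesis using assms(2) unfolding tensor2_space_def
  proof (induction rule: v.span_induct_alt)
    case base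
    then show ?case using assms(1) vector_space_field by (simp add: Vector_Spaces.linear_iff)
  next
    case (step c x y)
    then show ?case using assms(3,4)
      by (auto simp: Vector_Spaces.linear_iff tprod2_def fun_scale_def algebra_simps)
  qed
qed

lemma bilinear_contract:
  assumes "vector_space scale" and f: "linear_to_tensor2 scale f"
    and B: "trilinear_form scale B"
  shows "bilinear_form scale (\<lambda>v w. f w (\<lambda>x y. B v x y))"
    and "bilinear_form scale (\<lambda>v w. f v (\<lambda>x y. B x y w))"
proof -
  have 1: "Vector_Spaces.linear scale (*) (\<lambda>w. f w \<beta>)" for \<beta>
    using Vector_Spaces.linear_compose[OF _ linear_eval, of scale f \<beta>] f
    by (simp add: linear_to_tensor2_def o_def)
  have 2: "f w \<in> tensor2_space scale" for w using f by (auto simp: linear_to_tensor2_def)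
  show "bilinear_form scale (\<lambda>v w. f w (\<lambda>x y. B v x y))"
    unfolding bilinear_form_def using 1 tensor2_space_linear[OF assms(1) 2, of B] B
    by (simp add: trilinear_form_def bilinear_form_def)
  show "bilinear_form scale (\<lambda>v w. f v (\<lambda>x y. B x y w))"
    unfolding bilinear_form_def using 1 tensor2_space_linear[OF assms(1) 2, of "\<lambda>w x y. B x y w"] B
    by (simp add: trilinear_form_def bilinear_form_def)
qed

text \<open>Below, \<open>h\<close> is \<open>t \<mapsto> v \<otimes> t\<close>, respectively \<open>t \<mapsto> t \<otimes> w\<close>.\<close>

theorem id_tensor_tprod2:
  assumes "vector_space scale" and f: "linear_to_tensor2 scale f"
    and h: "Vector_Spaces.linear fun_scale fun_scale h"
      "\<And>x y. h (tprod2 scale x y) = tprod3 scale v x y"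
  shows "id_tensor scale f (tprod2 scale v w) = h (f w)"
proof -
  interpret p: vector_space_pair "fun_scale :: 'a \<Rightarrow> _ \<Rightarrow> ('b, 'a) tensor2"
      "fun_scale :: 'a \<Rightarrow> _ \<Rightarrow> ('b, 'a) tensor3"
    by (simp add: vector_space_pair_def vector_space_fun_scale)
  let ?h = "\<lambda>t B. if trilinear_form scale B then t (\<lambda>x y. B v x y) else 0"
  have lin: "Vector_Spaces.linear fun_scale fun_scale ?h"
    by (auto simp: Vector_Spaces.linear_iff vector_space_fun_scale fun_scale_def fun_eq_iff)
  have "f w \<in> p.vs1.span {tprod2 scale u v |u v. True}"
    using f by (auto simp: linear_to_tensor2_def tensor2_space_def)
  then have "h (f w) = ?h (f w)"
  proof (rule p.linear_eq_on[OF h(1) lin])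
    show "h b = ?h b" if "b \<in> {tprod2 scale u v |u v. True}" for b
    proof -
      obtain x y where b: "b = tprod2 scale x y" using \<open>b \<in> _\<close> by blast
      show ?thesis unfolding b h(2)
        by (rule ext) (simp add: tprod2_def tprod3_def trilinear_form_def bilinear_form_def)
    qed
  qed
  moreover have "id_tensor scale f (tprod2 scale v w) = ?h (f w)"
    using bilinear_contract(1)[OF assms(1) f] by (auto simp: id_tensor_def tprod2_def fun_eq_iff)
  ultimately show ?thesis by simp
qed

theorem tensor_id_tprod2:
  assumes "vector_space scale" and f: "linear_to_tensor2 scale f"
    and h: "Vector_Spaces.linear fun_scale fun_scale h"
      "\<And>x y. h (tprod2 scale x y) = tprod3 scale x y w"
  shows "tensor_id scale f (tprod2 scale v w) = h (f v)"
proof -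
  interpret p: vector_space_pair "fun_scale :: 'a \<Rightarrow> _ \<Rightarrow> ('b, 'a) tensor2"
      "fun_scale :: 'a \<Rightarrow> _ \<Rightarrow> ('b, 'a) tensor3"
    by (simp add: vector_space_pair_def vector_space_fun_scale)
  let ?h = "\<lambda>t B. if trilinear_form scale B then t (\<lambda>x y. B x y w) else 0"
  have lin: "Vector_Spaces.linear fun_scale fun_scale ?h"
    by (auto simp: Vector_Spaces.linear_iff vector_space_fun_scale fun_scale_def fun_eq_iff)
  have "f v \<in> p.vs1.span {tprod2 scale u v |u v. True}"
    using f by (auto simp: linear_to_tensor2_def tensor2_space_def)
  then have "h (f v) = ?h (f v)"
  proof (rule p.linear_eq_on[OF h(1) lin])
    show "h b = ?h b" if "b \<in> {tprod2 scale u v |u v. True}" for b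
    proof -
      obtain x y where b: "b = tprod2 scale x y" using \<open>b \<in> _\<close> by blast
      show ?thesis unfolding b h(2)
        by (rule ext) (simp add: tprod2_def tprod3_def trilinear_form_def bilinear_form_def)
    qed
  qed
  moreover have "tensor_id scale f (tprod2 scale v w) = ?h (f v)"
    using bilinear_contract(2)[OF assms(1) f] by (auto simp: tensor_id_def tprod2_def fun_eq_iff)
  ultimately show ?thesis by simp
qed

end

theory Submission
  imports Defs
begin

text \<open>
  All six composites are linear, so it suffices to compare them on the basis. There each side is a
  sum over \<open>j + l + m = i\<close> of elementary tensors; the scalars match because \<open>q\<close>
  is raised to the total index of the legs to the right of \<open>x\<close>, so splitting such a leg
  or iterating \<open>\<delta>h\<close> yields \<open>q ^ (l + m) = q ^ l * q ^ m\<close>.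
\<close>

lemma finite_add_eq: "finite {(j, k). j + k = (i::nat)}"
  by (rule finite_subset[of _ "{..i} \<times> {..i}"]) auto

text \<open>Both sides run over the triples with total \<open>i\<close>; they differ in which
  adjacent pair is summed first. This is the combinatorial core of all three axioms: splitting the
  right leg of a tensor yields the first form, splitting the left leg the second.\<close>

lemma sum_add_eq_assoc:
  fixes G :: "nat \<Rightarrow> nat \<Rightarrow> nat \<Rightarrow> 'b::comm_monoid_add"
  shows "(\<Sum>(j, k)\<in>{(j, k). j + k = i}. \<Sum>(l, m)\<in>{(l, m). l + m = k}. G j l m)
       = (\<Sum>(j, k)\<in>{(j, k). j + k = i}. \<Sum>(l, m)\<in>{(l, m). l + m = j}. G l m k)"
proof -
  let ?S = "\<lambda>i::nat. {(j, k). j + k = i}"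
  have "(\<Sum>p\<in>?S i. \<Sum>r\<in>?S (snd p). G (fst p) (fst r) (snd r))
      = (\<Sum>(p, r)\<in>Sigma (?S i) (\<lambda>p. ?S (snd p)). G (fst p) (fst r) (snd r))"
    by (rule sum.Sigma) (auto simp: finite_add_eq)
  also have "\<dots> = (\<Sum>(p, r)\<in>Sigma (?S i) (\<lambda>p. ?S (fst p)). G (fst r) (snd r) (snd p))"
    \<comment> \<open>The second witness re-brackets \<open>j + (l + m)\<close> as
      \<open>(j + l) + m\<close>; the first is its inverse.\<close>
    by (rule sum.reindex_bij_witness[
          of _ "\<lambda>((j, k), (l, m)). ((l, m + k), (m, k))" "\<lambda>((j, k), (l, m)). ((j + l, m), (j, l))"])
      auto
  also have "\<dots> = (\<Sum>p\<in>?S i. \<Sum>r\<in>?S (fst p). G (fst r) (snd r) (snd p))"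
    by (rule sum.Sigma[symmetric]) (auto simp: finite_add_eq)
  finally show ?thesis
    by (simp add: case_prod_unfold)
qed

lemma sum_fun_apply: "(\<Sum>i\<in>A. f i) B = (\<Sum>i\<in>A. f i B)"
  by (induction A rule: infinite_finite_induct) auto

text \<open>The first and third axioms apply the sum of the two coproducts to one leg, and
  \<open>bilinear_contract\<close> asks that this sum be a linear map into the tensor
  square.\<close>

lemma linear_to_tensor2_add:
  assumes "linear_to_tensor2 scale f" and "linear_to_tensor2 scale g"
  shows "linear_to_tensor2 scale (f + g)"
proof -
  interpret v: vector_space fun_scale by (rule vector_space_fun_scale)
  have "f v + g v \<in> tensor2_space scale" for v
    using assms v.span_add unfolding linear_to_tensor2_def tensor2_space_def by blast
  then show ?thesis
    using assms by (auto simp: linear_to_tensor2_def Vector_Spaces.linear_iff v.scale_right_distrib)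
qed

lemma id_tensor_apply:
  "trilinear_form scale B \<Longrightarrow> id_tensor scale f t B = t (\<lambda>v w. f w (\<lambda>x y. B v x y))"
  by (simp add: id_tensor_def)

lemma tensor_id_apply:
  "trilinear_form scale B \<Longrightarrow> tensor_id scale f t B = t (\<lambda>v w. f v (\<lambda>x y. B x y w))"
  by (simp add: tensor_id_def)

text \<open>In a composite the inner map is evaluated at \<open>B\<close> with its first or last
  argument frozen, so these are the forms at which the coproducts of basis vectors must be
  computed.\<close>

lemma trilinear_form_imp_bilinear_form:
  assumes "trilinear_form scale B"
  shows "bilinear_form scale (B v)"
    and "bilinear_form scale (\<lambda>x y. B x y w)"
  using assms by (simp_all add: trilinear_form_def bilinear_form_def)

text \<open>Elements of the tensor cube are functionals, so equality on \<open>S\<close> is tested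
  argument by argument; linearity carries it to the span.\<close>

lemma linear_tensor3_eqI:
  fixes F G :: "'e::ab_group_add \<Rightarrow> ('e, 'k::field) tensor3"
  assumes E: "vector_space scale"
    and span: "module.span scale S = UNIV"
    and F: "Vector_Spaces.linear scale fun_scale F"
    and G: "Vector_Spaces.linear scale fun_scale G"
    and outside: "\<And>v B. \<not> trilinear_form scale B \<Longrightarrow> F v B = G v B"
    and basis: "\<And>b B. b \<in> S \<Longrightarrow> trilinear_form scale B \<Longrightarrow> F b B = G b B"
  shows "F = G"
proof
  fix v
  interpret p: vector_space_pair scale "fun_scale :: 'k \<Rightarrow> ('e, 'k) tensor3 \<Rightarrow> _"
    using E by (simp add: vector_space_pair_def vector_space_fun_scale)
  have "v \<in> p.vs1.span S" using span by simp
  then show "F v = G v"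
    by (rule p.linear_eq_on[OF F G]) (use outside basis in blast)
qed

theorem theorem2p25:
  fixes n :: nat and q :: "'k::field"
    and scale :: "'k \<Rightarrow> 'e::ab_group_add \<Rightarrow> 'e"
    and a x :: "nat \<Rightarrow> 'e"
    and \<delta> \<delta>h :: "'e \<Rightarrow> ('e, 'k) tensor2"
  assumes k: "real_or_complex TYPE('k)"
    and n: "n > 0"
    and q: "q \<noteq> 0"
    and E: "vector_space scale"
    and basis: "inj_on a {..<n}" "inj_on x {..<n}" "a ` {..<n} \<inter> x ` {..<n} = {}"
      "\<not> module.dependent scale (a ` {..<n} \<union> x ` {..<n})"
      "module.span scale (a ` {..<n} \<union> x ` {..<n}) = UNIV"
    and linear: "linear_to_tensor2 scale \<delta>" "linear_to_tensor2 scale \<delta>h"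
    and \<delta>_a: "\<And>i. i < n \<Longrightarrow>
      \<delta> (a i) = (\<Sum>(j, k)\<in>{(j, k). j + k = i}. tprod2 scale (a j) (a k))"
    and \<delta>_x: "\<And>i. i < n \<Longrightarrow>
      \<delta> (x i) = (\<Sum>(j, k)\<in>{(j, k). j + k = i}. tprod2 scale (a j) (x k))"
    and \<delta>h_a: "\<And>i. i < n \<Longrightarrow> \<delta>h (a i) = 0"
    and \<delta>h_x: "\<And>i. i < n \<Longrightarrow>
      \<delta>h (x i) = (\<Sum>(j, k)\<in>{(j, k). j + k = i}. fun_scale (q ^ k) (tprod2 scale (x j) (a k)))"
  shows "dendriform_coalgebra scale \<delta> \<delta>h"
proof -
  let ?S = "\<lambda>i::nat. {(j, k). j + k = i}"
  interpret vector_space scale by (rule E)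
  have sum: "linear_to_tensor2 scale (\<delta> + \<delta>h)" "linear_to_tensor2 scale (\<delta>h + \<delta>)"
    using linear by (simp_all add: linear_to_tensor2_add)
  have lin: "Vector_Spaces.linear scale fun_scale (id_tensor scale f \<circ> g)"
    "Vector_Spaces.linear scale fun_scale (tensor_id scale f \<circ> g)"
    if "linear_to_tensor2 scale g" for f g
    using that by (auto simp: linear_to_tensor2_def
        intro: Vector_Spaces.linear_compose linear_id_tensor linear_tensor_id)
  have eq: "\<phi> = \<psi>"
    if "Vector_Spaces.linear scale fun_scale \<phi>" "Vector_Spaces.linear scale fun_scale \<psi>"
      and "\<And>v B. \<not> trilinear_form scale B \<Longrightarrow> \<phi> v B = \<psi> v B"
      and "\<And>i B. i < n \<Longrightarrow> trilinear_form scale B \<Longrightarrow> \<phi> (a i) B = \<psi> (a i) B"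
      and "\<And>i B. i < n \<Longrightarrow> trilinear_form scale B \<Longrightarrow> \<phi> (x i) B = \<psi> (x i) B"
    for \<phi> \<psi> :: "'e \<Rightarrow> ('e, 'k) tensor3"
    by (rule linear_tensor3_eqI[OF E basis(5) that(1,2)]) (use that(3-) in auto)
  \<comment> \<open>Evaluation at a bilinear form replaces each elementary tensor by a scalar, so
    that the axioms become identities between finite sums in \<open>'k\<close>.\<close>
  have d_a: "\<delta> (a i) C = (\<Sum>(j, k)\<in>?S i. C (a j) (a k))"
    if "i < n" "bilinear_form scale C" for i C
    using that by (simp add: \<delta>_a sum_fun_apply tprod2_def case_prod_unfold)
  have d_x: "\<delta> (x i) C = (\<Sum>(j, k)\<in>?S i. C (a j) (x k))"
    if "i < n" "bilinear_form scale C" for i C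
    using that by (simp add: \<delta>_x sum_fun_apply tprod2_def case_prod_unfold)
  have h_a: "\<delta>h (a i) C = 0" if "i < n" for i C
    using that by (simp add: \<delta>h_a)
  have h_x: "\<delta>h (x i) C = (\<Sum>(j, k)\<in>?S i. q ^ k * C (x j) (a k))"
    if "i < n" "bilinear_form scale C" for i C
    using that by (simp add: \<delta>h_x sum_fun_apply fun_scale_def tprod2_def case_prod_unfold)
  \<comment> \<open>\<open>contract\<close> licenses the evaluation of the outer coproduct,
    \<open>bil\<close> that of the inner one.\<close>
  note contract = bilinear_contract[OF E]
  note bil = trilinear_form_imp_bilinear_form
  \<comment> \<open>Both indices are at most \<open>i\<close>, hence below \<open>n\<close>, so the
    defining formulas apply again to each leg.\<close>
  have cong: "(\<Sum>(j, k)\<in>?S i. F j k) = (\<Sum>(j, k)\<in>?S i. G j k)"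
    if "i < n" "\<And>j k. j < n \<Longrightarrow> k < n \<Longrightarrow> F j k = G j k" for i and F G :: "nat \<Rightarrow> nat \<Rightarrow> 'k"
    using that by (intro sum.cong) auto
  show ?thesis
  proof
    show "id_tensor scale (\<delta> + \<delta>h) \<circ> \<delta>h = tensor_id scale \<delta>h \<circ> \<delta>h"
    proof (rule eq[OF lin(1)[OF linear(2)] lin(2)[OF linear(2)]])
      fix i B assume i: "i < n" and B: "trilinear_form scale B"
      show "(id_tensor scale (\<delta> + \<delta>h) \<circ> \<delta>h) (a i) B = (tensor_id scale \<delta>h \<circ> \<delta>h) (a i) B"
        using i B by (simp add: id_tensor_apply tensor_id_apply h_a)
      \<comment> \<open>The sum \<open>\<delta> + \<delta>h\<close> is kept unexpanded so that
        \<open>contract\<close> applies to it as a single map.\<close>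
      have "(id_tensor scale (\<delta> + \<delta>h) \<circ> \<delta>h) (x i) B
          = (\<Sum>(j, k)\<in>?S i. q ^ k * (\<delta> + \<delta>h) (a k) (B (x j)))"
        using i B by (simp add: id_tensor_apply h_x contract(1) sum del: plus_fun_apply)
      \<comment> \<open>Only \<open>\<delta>\<close> contributes on \<open>a k\<close>, and
        \<open>k = l + m\<close> splits the power of \<open>q\<close>.\<close>
      also have "\<dots> = (\<Sum>(j, k)\<in>?S i. \<Sum>(l, m)\<in>?S k. q ^ l * q ^ m * B (x j) (a l) (a m))"
        by (rule cong[OF i]) (auto simp: d_a h_a bil[OF B] sum_distrib_left mult.assoc
            power_add intro!: sum.cong)
      also have "\<dots> = (\<Sum>(j, k)\<in>?S i. \<Sum>(l, m)\<in>?S j. q ^ m * q ^ k * B (x l) (a m) (a k))"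
        by (rule sum_add_eq_assoc)
      \<comment> \<open>The factor \<open>q ^ m\<close> is absorbed by the inner
        \<open>\<delta>h\<close>, while \<open>q ^ k\<close> belongs to the outer one.\<close>
      also have "\<dots> = (\<Sum>(j, k)\<in>?S i. q ^ k * \<delta>h (x j) (\<lambda>u v. B u v (a k)))"
        by (rule cong[OF i]) (auto simp: h_x bil[OF B] sum_distrib_left mult_ac intro!: sum.cong)
      also have "\<dots> = (tensor_id scale \<delta>h \<circ> \<delta>h) (x i) B"
        using i B by (simp add: tensor_id_apply h_x contract(2) linear)
      finally show "(id_tensor scale (\<delta> + \<delta>h) \<circ> \<delta>h) (x i) B
          = (tensor_id scale \<delta>h \<circ> \<delta>h) (x i) B" .
    \<comment> \<open>The remaining case is a \<open>B\<close> that is not trilinear, where both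
      sides are 0 by definition.\<close>
    qed (simp add: id_tensor_def tensor_id_def)
  next
    show "id_tensor scale \<delta>h \<circ> \<delta> = tensor_id scale \<delta> \<circ> \<delta>h"
    proof (rule eq[OF lin(1)[OF linear(1)] lin(2)[OF linear(2)]])
      fix i B assume i: "i < n" and B: "trilinear_form scale B"
      have "(id_tensor scale \<delta>h \<circ> \<delta>) (a i) B = (\<Sum>(j, k)\<in>?S i. \<delta>h (a k) (B (a j)))"
        using i B by (simp add: id_tensor_apply d_a contract(1) linear)
      \<comment> \<open>Every right leg of \<open>\<delta> (a i)\<close> is some \<open>a k\<close>,
        which \<open>\<delta>h\<close> kills.\<close>
      also have "\<dots> = (\<Sum>(j, k)\<in>?S i. 0)"
        by (rule cong[OF i]) (simp add: h_a)
      also have "\<dots> = (tensor_id scale \<delta> \<circ> \<delta>h) (a i) B"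
        using i B by (simp add: tensor_id_apply h_a)
      finally show "(id_tensor scale \<delta>h \<circ> \<delta>) (a i) B = (tensor_id scale \<delta> \<circ> \<delta>h) (a i) B" .
      have "(id_tensor scale \<delta>h \<circ> \<delta>) (x i) B = (\<Sum>(j, k)\<in>?S i. \<delta>h (x k) (B (a j)))"
        using i B by (simp add: id_tensor_apply d_x contract(1) linear)
      also have "\<dots> = (\<Sum>(j, k)\<in>?S i. \<Sum>(l, m)\<in>?S k. q ^ m * B (a j) (x l) (a m))"
        by (rule cong[OF i]) (simp add: h_x bil[OF B])
      \<comment> \<open>The weight depends only on the last leg, so regrouping turns the inner
        exponent into the outer one, as produced by \<open>\<delta>h (x i)\<close>.\<close>
      also have "\<dots> = (\<Sum>(j, k)\<in>?S i. \<Sum>(l, m)\<in>?S j. q ^ k * B (a l) (x m) (a k))"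
        by (rule sum_add_eq_assoc)
      also have "\<dots> = (\<Sum>(j, k)\<in>?S i. q ^ k * \<delta> (x j) (\<lambda>u v. B u v (a k)))"
        by (rule cong[OF i]) (auto simp: d_x bil[OF B] sum_distrib_left intro!: sum.cong)
      also have "\<dots> = (tensor_id scale \<delta> \<circ> \<delta>h) (x i) B"
        using i B by (simp add: tensor_id_apply h_x contract(2) linear)
      finally show "(id_tensor scale \<delta>h \<circ> \<delta>) (x i) B = (tensor_id scale \<delta> \<circ> \<delta>h) (x i) B" .
    qed (simp add: id_tensor_def tensor_id_def)
  next
    show "tensor_id scale (\<delta>h + \<delta>) \<circ> \<delta> = id_tensor scale \<delta> \<circ> \<delta>"
    proof (rule eq[OF lin(2)[OF linear(1)] lin(1)[OF linear(1)]])
      fix i B assume i: "i < n" and B: "trilinear_form scale B"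
      \<comment> \<open>The left leg of \<open>\<delta>\<close> is an \<open>a j\<close> on both
        families, so one computation with last leg \<open>y\<close> serves for \<open>y = a\<close>
        and \<open>y = x\<close>; on \<open>a j\<close> the sum reduces to
        \<open>\<delta>\<close>.\<close>
      have assoc: "(\<Sum>(j, k)\<in>?S i. (\<delta>h + \<delta>) (a j) (\<lambda>u v. B u v (y k)))
          = (\<Sum>(j, k)\<in>?S i. \<Sum>(l, m)\<in>?S k. B (a j) (a l) (y m))" for y
        unfolding sum_add_eq_assoc
        by (rule cong[OF i]) (simp add: d_a h_a bil[OF B])
      have "(tensor_id scale (\<delta>h + \<delta>) \<circ> \<delta>) (a i) B
          = (\<Sum>(j, k)\<in>?S i. (\<delta>h + \<delta>) (a j) (\<lambda>u v. B u v (a k)))"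
        using i B by (simp add: tensor_id_apply d_a contract(2) sum del: plus_fun_apply)
      also have "\<dots> = (\<Sum>(j, k)\<in>?S i. \<delta> (a k) (B (a j)))"
        unfolding assoc by (rule cong[OF i]) (simp add: d_a bil[OF B])
      also have "\<dots> = (id_tensor scale \<delta> \<circ> \<delta>) (a i) B"
        using i B by (simp add: id_tensor_apply d_a contract(1) linear)
      finally show "(tensor_id scale (\<delta>h + \<delta>) \<circ> \<delta>) (a i) B = (id_tensor scale \<delta> \<circ> \<delta>) (a i) B" .
      have "(tensor_id scale (\<delta>h + \<delta>) \<circ> \<delta>) (x i) B
          = (\<Sum>(j, k)\<in>?S i. (\<delta>h + \<delta>) (a j) (\<lambda>u v. B u v (x k)))"
        using i B by (simp add: tensor_id_apply d_x contract(2) sum del: plus_fun_apply)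
      also have "\<dots> = (\<Sum>(j, k)\<in>?S i. \<delta> (x k) (B (a j)))"
        unfolding assoc by (rule cong[OF i]) (simp add: d_x bil[OF B])
      also have "\<dots> = (id_tensor scale \<delta> \<circ> \<delta>) (x i) B"
        using i B by (simp add: id_tensor_apply d_x contract(1) linear)
      finally show "(tensor_id scale (\<delta>h + \<delta>) \<circ> \<delta>) (x i) B = (id_tensor scale \<delta> \<circ> \<delta>) (x i) B" .
    qed (simp add: id_tensor_def tensor_id_def)
  qed (fact linear)+
qed

end
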